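(* Let $n\ge 1$ be an integer. When restricted to the matchings of $[2n]$ with no left-nestings and no right-crossings, the map $\psi$ (defined in the context) is a bijection onto $\mathcal{T}^{01}_n$.
   Context: $[m]=\{1,\dots,m\}$. A matching of $[2n]$ is a partition of $[2n]$ into blocks of size $2$; the blocks are called arcs and written $(i,j)$ with $i<j$; $i$ is the opener and $j$ the closer of the arc. A nesting is a pair of arcs $(i,\ell)$, $(j,k)$ with $i<j<k<\ell$; it is a left-nesting if $j=i+1$. A crossing is a pair of arcs $(i,k)$, $(j,\ell)$ with $i<j<k<\ell$; it is a right-crossing if $\ell=k+1$. $\mathcal{T}_n$ is the set of upper triangular (square) matrices, of any size, with non-negative integer entries, such that no row or column has only zeros and the total sum of the entries is $n$. $\mathcal{T}^{01}_n\subset\mathcal{T}_n$ is the subset of matrices all of whose entries are $0$ or $1$. Map $\psi$: for a matching $M$ of $[2n]$ let $O(M)$ and $C(M)$ be its sets of openers and closers. Write $O(M)=O_1\cup\dots\cup O_k$ and $C(M)=C_1\cup\dots\cup C_k$ as disjoint unions of maximal intervals of consecutive integers, each list ordered in the natural order (the number $k$ of intervals is the same for openers and closers). Then $\psi(M)=(t_{ij})$ is the $k\times k$ matrix with $t_{ij}=|M\cap (O_i\times C_j)|$, the number of arcs whose opener is in $O_i$ and whose closer is in $C_j$. *)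

theory Defs
  imports "HOL-Library.Disjoint_Sets" "Jordan_Normal_Form.Matrix"
begin

definition matching_of :: "nat \<Rightarrow> nat set set \<Rightarrow> bool" where
  "matching_of n M \<longleftrightarrow> partition_on {1..2 * n} M \<and> (\<forall>B\<in>M. card B = 2)"

definition arcs :: "nat set set \<Rightarrow> (nat \<times> nat) set" where
  "arcs M = {(i, j). i < j \<and> {i, j} \<in> M}"

definition openers :: "nat set set \<Rightarrow> nat set" where
  "openers M = fst ` arcs M"

definition closers :: "nat set set \<Rightarrow> nat set" where
  "closers M = snd ` arcs M"

definition nestings :: "nat set set \<Rightarrow> ((nat \<times> nat) \<times> (nat \<times> nat)) set" where
  "nestings M = {((i, l), (j, k)) | i j k l.
     (i, l) \<in> arcs M \<and> (j, k) \<in> arcs M \<and> i < j \<and> j < k \<and> k < l}"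

definition left_nestings :: "nat set set \<Rightarrow> ((nat \<times> nat) \<times> (nat \<times> nat)) set" where
  "left_nestings M = {((i, l), (j, k)) | i j k l.
     ((i, l), (j, k)) \<in> nestings M \<and> j = i + 1}"

definition crossings :: "nat set set \<Rightarrow> ((nat \<times> nat) \<times> (nat \<times> nat)) set" where
  "crossings M = {((i, k), (j, l)) | i j k l.
     (i, k) \<in> arcs M \<and> (j, l) \<in> arcs M \<and> i < j \<and> j < k \<and> k < l}"

definition right_crossings :: "nat set set \<Rightarrow> ((nat \<times> nat) \<times> (nat \<times> nat)) set" where
  "right_crossings M = {((i, k), (j, l)) | i j k l.
     ((i, k), (j, l)) \<in> crossings M \<and> l = k + 1}"

definition max_intervals :: "nat set \<Rightarrow> nat set set" where
  "max_intervals S = {{a..b} | a b. a \<le> b \<and> {a..b} \<subseteq> S \<and>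
     (\<forall>c d. {a..b} \<subseteq> {c..d} \<and> {c..d} \<subseteq> S \<longrightarrow> {c..d} = {a..b})}"

text \<open>Distinct maximal intervals are disjoint, so sorting them by their least elements gives
  their natural order from left to right.\<close>

definition interval_list :: "nat set \<Rightarrow> nat set list" where
  "interval_list S = sorted_key_list_of_set Min (max_intervals S)"

text \<open>Rows and columns are numbered from \<open>0\<close>. In a matching the opener intervals and the
  closer intervals alternate, so both lists have the same length and the matrix is square.\<close>

definition psi :: "nat set set \<Rightarrow> nat mat" where
  "psi M = (let Os = interval_list (openers M); Cs = interval_list (closers M)
     in mat (length Os) (length Cs) (\<lambda>(i, j). card (arcs M \<inter> (Os ! i \<times> Cs ! j))))"

definition T :: "nat \<Rightarrow> nat mat set" where
  "T n = {A. square_mat A \<and> upper_triangular A \<and>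
     (\<forall>i < dim_row A. \<exists>j < dim_col A. A $$ (i, j) \<noteq> 0) \<and>
     (\<forall>j < dim_col A. \<exists>i < dim_row A. A $$ (i, j) \<noteq> 0) \<and>
     sum_mat A = n}"

definition T01 :: "nat \<Rightarrow> nat mat set" where
  "T01 n = {A \<in> T n. elements_mat A \<subseteq> {0, 1}}"

end

theory Submission
  imports Defs "HOL-Library.Product_Lexorder"
begin

text \<open>Cut \<open>{1..2 * n}\<close> into its maximal runs of openers and of closers. The runs alternate,
  beginning with openers and ending with closers, so they carry consecutive levels
  \<open>0, 1, \<dots>, 2 * k - 1\<close>: row \<open>i\<close> of \<open>psi M\<close> belongs to level \<open>2 * i\<close> and column \<open>j\<close> to level
  \<open>2 * j + 1\<close>. Any monotone map of \<open>{1..2 * n}\<close> onto \<open>{..<2 * k}\<close> that is even exactly on the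
  openers recovers these runs (\<open>interval_list_parity_class\<close>), and \<open>psi M\<close> counts the arcs between
  given levels (\<open>psi_levels\<close>).

  If no two adjacent openers start a nesting, then along a whole run of openers the partners
  increase; if no two adjacent closers end a crossing, then along a whole run of closers the
  partners decrease. Two arcs joining the same two runs would have to obey both rules, which
  contradict each other, so the entries of \<open>psi M\<close> are at most \<open>1\<close> and an arc is determined by its
  cell \<open>(i, j)\<close>. The rules also say where the endpoints lie: within row \<open>i\<close> the openers appear by
  increasing column, and within column \<open>j\<close> the closers appear by decreasing row. So if the opener
  of the arc in cell \<open>(i, j)\<close> gets the key \<open>(2 * i, j)\<close> and its closer gets \<open>(2 * j + 1, - i)\<close>,
  the points \<open>1, \<dots>, 2 * n\<close> carry their keys in increasing lexicographic order
  (\<open>key_labelling_exists\<close>). The set of keys depends only on the support of the matrix, and a finite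
  linearly ordered set has only one increasing enumeration, so \<open>psi\<close> is injective.

  Conversely, the keys of the nonzero cells of a matrix in \<open>T01 n\<close> can be enumerated in increasing
  order and linked in pairs (\<open>T01_preimage\<close>). Upper triangularity makes every arc point to the
  right, and since no row or column vanishes every level occurs, so that the runs of the
  resulting matching are precisely the levels.\<close>

section \<open>Matchings as sets of arcs\<close>

text \<open>The arcs of a matching of \<open>{1..N}\<close>, without reference to its blocks; the two translations
  are \<open>matching_arc_diagram\<close> and \<open>arcs_of_arc_diagram\<close>.\<close>

definition arc_diagram :: "nat \<Rightarrow> (nat \<times> nat) set \<Rightarrow> bool" where
  "arc_diagram N R \<longleftrightarrow> (\<forall>(a, c)\<in>R. a < c) \<and> inj_on fst R \<and> inj_on snd R \<and>
     fst ` R \<inter> snd ` R = {} \<and> fst ` R \<union> snd ` R = {1..N}"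

lemma arc_diagramD:
  assumes "arc_diagram N R"
  shows "(a, c) \<in> R \<Longrightarrow> a < c"
    and "(a, c) \<in> R \<Longrightarrow> a \<in> {1..N} \<and> c \<in> {1..N}"
    and "(a, c) \<in> R \<Longrightarrow> (a, c') \<in> R \<Longrightarrow> c = c'"
    and "(a, c) \<in> R \<Longrightarrow> (a', c) \<in> R \<Longrightarrow> a = a'"
    and "x \<in> {1..N} \<Longrightarrow> x \<notin> fst ` R \<longleftrightarrow> x \<in> snd ` R"
    and "(a, c) \<in> R \<Longrightarrow> (c, d) \<notin> R"
    and "finite R"
proof -
  show "(a, c) \<in> R \<Longrightarrow> a < c"
    using assms by (auto simp: arc_diagram_def)
  show "(a, c) \<in> R \<Longrightarrow> a \<in> {1..N} \<and> c \<in> {1..N}"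
    using assms unfolding arc_diagram_def by (metis UnI1 UnI2 fst_conv imageI snd_conv)
  show "(a, c) \<in> R \<Longrightarrow> (a, c') \<in> R \<Longrightarrow> c = c'"
    using assms unfolding arc_diagram_def by (metis fst_conv inj_onD prod.inject)
  show "(a, c) \<in> R \<Longrightarrow> (a', c) \<in> R \<Longrightarrow> a = a'"
    using assms unfolding arc_diagram_def by (metis snd_conv inj_onD prod.inject)
  show "x \<in> {1..N} \<Longrightarrow> x \<notin> fst ` R \<longleftrightarrow> x \<in> snd ` R"
    using assms unfolding arc_diagram_def by blast
  show "(a, c) \<in> R \<Longrightarrow> (c, d) \<notin> R"
    using assms unfolding arc_diagram_def by (metis disjoint_iff fst_conv imageI snd_conv)
  have "finite (fst ` R)" "inj_on fst R"
    using assms unfolding arc_diagram_def by (metis finite_Un finite_atLeastAtMost) (use assms in \<open>simp add: arc_diagram_def\<close>)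
  then show "finite R"
    using finite_imageD by blast
qed

lemma arc_diagram_card:
  assumes "arc_diagram N R"
  shows "N = 2 * card R"
proof -
  have "card {1..N} = card (fst ` R) + card (snd ` R)"
    using assms arc_diagramD(7)[OF assms]
    by (metis arc_diagram_def card_Un_disjoint finite_imageI)
  then show ?thesis
    using assms by (simp add: arc_diagram_def card_image)
qed

lemma matching_block:
  assumes "matching_of n M" "B \<in> M"
  obtains a c where "B = {a, c}" "a < c" "(a, c) \<in> arcs M"
proof -
  have "card B = 2"
    using assms by (auto simp: matching_of_def)
  then obtain u v where uv: "B = {u, v}" "u \<noteq> v"
    by (auto simp: card_2_iff)
  show ?thesis
  proof (cases "u < v")
    case True
    then show ?thesis using that[of u v] uv assms by (auto simp: arcs_def)
  next
    case False
    then show ?thesis using that[of v u] uv assms by (auto simp: arcs_def insert_commute)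
  qed
qed

lemma matching_blocks_eq:
  assumes "matching_of n M" "B \<in> M" "B' \<in> M" "x \<in> B" "x \<in> B'"
  shows "B = B'"
  using assms unfolding matching_of_def partition_on_def disjoint_def by blast

lemma matching_arc_diagram:
  assumes M: "matching_of n M"
  shows "arc_diagram (2 * n) (arcs M)"
proof -
  have U: "\<Union>M = {1..2 * n}"
    using M by (simp add: matching_of_def partition_on_def)
  have eq: "{a, c} = {a', c'}" if "(a, c) \<in> arcs M" "(a', c') \<in> arcs M" "{a, c} \<inter> {a', c'} \<noteq> {}"
    for a c a' c'
    using that matching_blocks_eq[OF M] unfolding arcs_def by blast
  have 1: "inj_on fst (arcs M)"
    using eq by (fastforce simp: inj_on_def doubleton_eq_iff arcs_def)
  have 2: "inj_on snd (arcs M)"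
    using eq by (fastforce simp: inj_on_def doubleton_eq_iff arcs_def)
  have 3: "fst ` arcs M \<inter> snd ` arcs M = {}"
  proof (rule ccontr)
    assume "fst ` arcs M \<inter> snd ` arcs M \<noteq> {}"
    then obtain a c d where "(a, c) \<in> arcs M" "(c, d) \<in> arcs M"
      by auto
    then show False
      using eq[of a c c d] by (auto simp: doubleton_eq_iff arcs_def)
  qed
  have 4: "fst ` arcs M \<union> snd ` arcs M = {1..2 * n}"
  proof
    show "fst ` arcs M \<union> snd ` arcs M \<subseteq> {1..2 * n}"
      unfolding U[symmetric] by (auto simp: arcs_def)
    show "{1..2 * n} \<subseteq> fst ` arcs M \<union> snd ` arcs M"
    proof
      fix x assume "x \<in> {1..2 * n}"
      then obtain B where "B \<in> M" "x \<in> B"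
        using U by blast
      then show "x \<in> fst ` arcs M \<union> snd ` arcs M"
        using matching_block[OF M \<open>B \<in> M\<close>] by (metis UnI1 UnI2 empty_iff fst_conv imageI insert_iff snd_conv)
    qed
  qed
  show ?thesis
    using 1 2 3 4 by (auto simp: arc_diagram_def arcs_def)
qed

lemma matching_from_arcs:
  assumes "matching_of n M"
  shows "M = (\<lambda>(a, c). {a, c}) ` arcs M"
proof
  show "M \<subseteq> (\<lambda>(a, c). {a, c}) ` arcs M"
    using matching_block[OF assms] by (metis (mono_tags, lifting) case_prod_conv image_iff subsetI)
qed (auto simp: arcs_def)

lemma arcs_of_arc_diagram:
  assumes R: "arc_diagram (2 * n) R"
  defines "M \<equiv> (\<lambda>(a, c). {a, c}) ` R"
  shows "matching_of n M" and "arcs M = R"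
proof -
  note D = arc_diagramD[OF R]
  have card: "card B = 2" if "B \<in> M" for B
    using that D(1) by (fastforce simp: M_def card_2_iff)
  have U: "\<Union>M = {1..2 * n}"
  proof -
    have "\<Union>M = fst ` R \<union> snd ` R"
      by (auto simp: M_def image_iff) (metis fst_conv snd_conv)+
    then show ?thesis using R by (simp add: arc_diagram_def)
  qed
  have disj: "disjoint M"
  proof (rule disjointI)
    fix B B' assume "B \<in> M" "B' \<in> M" "B \<noteq> B'"
    then show "B \<inter> B' = {}"
      using D(3,4,6) unfolding M_def by (auto; blast)
  qed
  have "{} \<notin> M"
    using card by fastforce
  then show "matching_of n M"
    using U disj card by (auto simp: matching_of_def partition_on_def)
  show "arcs M = R"
    using D(1) by (force simp: arcs_def M_def doubleton_eq_iff)
qed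

text \<open>Requiring the strict order of the other two endpoints turns the absence of the patterns into
  positive rules that can be iterated along a run.\<close>

definition no_left_nesting :: "(nat \<times> nat) set \<Rightarrow> bool" where
  "no_left_nesting R \<longleftrightarrow> (\<forall>a c c'. (a, c) \<in> R \<longrightarrow> (Suc a, c') \<in> R \<longrightarrow> c < c')"

definition no_right_crossing :: "(nat \<times> nat) set \<Rightarrow> bool" where
  "no_right_crossing R \<longleftrightarrow> (\<forall>a a' c. (a, c) \<in> R \<longrightarrow> (a', Suc c) \<in> R \<longrightarrow> a' < a)"

lemma no_left_nesting_iff:
  assumes "matching_of n M"
  shows "left_nestings M = {} \<longleftrightarrow> no_left_nesting (arcs M)"
proof -
  note D = arc_diagramD[OF matching_arc_diagram[OF assms]]
  have "left_nestings M = {} \<longleftrightarrow> (\<forall>a c c'. (a, c) \<in> arcs M \<longrightarrow> (Suc a, c') \<in> arcs M \<longrightarrow> \<not> c' < c)"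
    unfolding left_nestings_def nestings_def by (auto dest: D(1))
  also have "\<dots> \<longleftrightarrow> no_left_nesting (arcs M)"
    unfolding no_left_nesting_def using D(4) by (metis linorder_neqE_nat n_not_Suc_n not_less_iff_gr_or_eq)
  finally show ?thesis .
qed

lemma no_right_crossing_iff:
  assumes "matching_of n M"
  shows "right_crossings M = {} \<longleftrightarrow> no_right_crossing (arcs M)"
proof -
  note D = arc_diagramD[OF matching_arc_diagram[OF assms]]
  have *: "a' < c" if "(a, c) \<in> arcs M" "(a', Suc c) \<in> arcs M" for a a' c
    using that D(1)[OF that(2)] D(6) by (metis less_antisym)
  have "right_crossings M = {} \<longleftrightarrow> (\<forall>a a' c. (a, c) \<in> arcs M \<longrightarrow> (a', Suc c) \<in> arcs M \<longrightarrow> \<not> a < a')"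
    unfolding right_crossings_def crossings_def by (auto dest: *)
  also have "\<dots> \<longleftrightarrow> no_right_crossing (arcs M)"
    unfolding no_right_crossing_def using D(3) by (metis linorder_neqE_nat n_not_Suc_n not_less_iff_gr_or_eq)
  finally show ?thesis .
qed

section \<open>Maximal intervals and level maps\<close>

lemma (in linorder) sorted_key_list_of_set_set:
  assumes "inj_on f (set xs)" "distinct xs" "sorted (map f xs)"
  shows "sorted_key_list_of_set f (set xs) = xs"
proof -
  interpret folding_insort_key "(\<le>)" "(<)" "set xs" f
    by standard (rule assms)
  show ?thesis
    by (rule idem_if_sorted_distinct) (use assms in simp_all)
qed

lemma eq_Collect_in: "A \<subseteq> X \<Longrightarrow> (\<And>x. x \<in> X \<Longrightarrow> P x \<longleftrightarrow> x \<in> A) \<Longrightarrow> A = {x \<in> X. P x}"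
  by blast

text \<open>An abstract version of the run number of a point, counted from \<open>0\<close>.\<close>

locale level_map =
  fixes N k :: nat and b :: "nat \<Rightarrow> nat"
  assumes mono: "\<lbrakk>x \<in> {1..N}; y \<in> {1..N}; x \<le> y\<rbrakk> \<Longrightarrow> b x \<le> b y"
    and onto: "b ` {1..N} = {..<2 * k}"
begin

lemma less_if_level_less:
  assumes "x \<in> {1..N}" "y \<in> {1..N}" "b x < b y"
  shows "x < y"
  using mono[of y x] assms by force

text \<open>A monotone map that skips no value passes through the value \<open>b c + 1\<close>, of the wrong parity,
  before it can leave the value \<open>b c\<close>.\<close>

lemma level_constant:
  assumes "{c..d} \<subseteq> {x \<in> {1..N}. b x mod 2 = p}" "c \<le> d"
  shows "b c = b d"
proof (rule ccontr)
  assume ne: "b c \<noteq> b d"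
  have cd: "c \<in> {1..N}" "d \<in> {1..N}" "b c mod 2 = p" "b d mod 2 = p"
    using assms by auto
  then have "b c < b d"
    using mono ne assms(2) by (simp add: order_less_le)
  moreover have "b d \<noteq> Suc (b c)"
  proof -
    have "even (b d) \<longleftrightarrow> even (b c)"
      using cd(3,4) by (simp add: even_iff_mod_2_eq_zero)
    then show ?thesis by auto
  qed
  ultimately have less: "Suc (b c) < b d"
    by simp
  have "b d \<in> {..<2 * k}"
    using cd onto by blast
  then have "Suc (b c) \<in> b ` {1..N}"
    using less onto by simp
  then obtain x where x: "x \<in> {1..N}" "b x = Suc (b c)"
    by force
  then have "c \<le> x" "x \<le> d"
    using less_if_level_less cd less by (metis lessI less_imp_le)+
  then have "b x mod 2 = b c mod 2"
    using assms cd(3) by auto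
  then show False
    using x(2) by (simp add: mod_Suc split: if_splits)
qed

abbreviation fiber :: "nat \<Rightarrow> nat set" where
  "fiber v \<equiv> {x \<in> {1..N}. b x = v}"

lemma fiber_nonempty: "v < 2 * k \<Longrightarrow> fiber v \<noteq> {}"
  using onto by (smt (verit) empty_Collect_eq imageE lessThan_iff)

lemma fiber_interval:
  assumes "v < 2 * k"
  shows "fiber v = {Min (fiber v)..Max (fiber v)}"
proof
  have fin: "finite (fiber v)" by simp
  have "Min (fiber v) \<in> fiber v" "Max (fiber v) \<in> fiber v"
    using Min_in Max_in fin fiber_nonempty[OF assms] by blast+
  then have ends: "Min (fiber v) \<in> {1..N}" "b (Min (fiber v)) = v"
    "Max (fiber v) \<in> {1..N}" "b (Max (fiber v)) = v"
    by blast+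
  show "{Min (fiber v)..Max (fiber v)} \<subseteq> fiber v"
  proof
    fix x assume x: "x \<in> {Min (fiber v)..Max (fiber v)}"
    then have "x \<in> {1..N}" using ends by (meson atLeastAtMost_iff order_trans)
    moreover have "b x = v"
      using mono[OF ends(1) \<open>x \<in> {1..N}\<close>] mono[OF \<open>x \<in> {1..N}\<close> ends(3)] ends x by simp
    ultimately show "x \<in> fiber v" by simp
  qed
  show "fiber v \<subseteq> {Min (fiber v)..Max (fiber v)}"
    using fin by auto
qed

text \<open>Every fiber is an interval, and by \<open>level_constant\<close> every interval inside a parity class lies
  in a single fiber, so the fibers are the maximal intervals.\<close>

lemma max_intervals_parity_class:
  assumes "p < 2"
  shows "max_intervals {x \<in> {1..N}. b x mod 2 = p} = (\<lambda>i. fiber (2 * i + p)) ` {..<k}"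
    (is "max_intervals ?S = _")
proof
  have sub: "{c..d} \<subseteq> fiber (b c)" if "{c..d} \<subseteq> ?S" for c d
  proof
    fix x assume x: "x \<in> {c..d}"
    then have "{c..x} \<subseteq> {c..d}" by simp
    then have "{c..x} \<subseteq> ?S" using that by (rule subset_trans)
    then show "x \<in> fiber (b c)"
      using level_constant[of c x p] x that by fastforce
  qed
  have fibS: "fiber (2 * i + p) \<subseteq> ?S" for i
    using assms by auto
  show "max_intervals ?S \<subseteq> (\<lambda>i. fiber (2 * i + p)) ` {..<k}"
  proof
    fix I assume "I \<in> max_intervals ?S"
    then have "\<exists>a d. I = {a..d} \<and> a \<le> d \<and> {a..d} \<subseteq> ?S \<and>
        (\<forall>c e. {a..d} \<subseteq> {c..e} \<and> {c..e} \<subseteq> ?S \<longrightarrow> {c..e} = {a..d})"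
      unfolding max_intervals_def mem_Collect_eq .
    then obtain a d where I: "I = {a..d}" "a \<le> d" "{a..d} \<subseteq> ?S"
      and mx: "\<forall>c e. {a..d} \<subseteq> {c..e} \<and> {c..e} \<subseteq> ?S \<longrightarrow> {c..e} = {a..d}"
      by (elim exE conjE) (rule that)
    define i where "i = b a div 2"
    have a: "a \<in> {1..N}" "b a mod 2 = p" using I by auto
    then have ba: "b a = 2 * i + p" by (auto simp: i_def)
    have lt: "b a < 2 * k" using a onto by blast
    have "{a..d} \<subseteq> fiber (b a)" "fiber (b a) \<subseteq> ?S"
      using sub[OF I(3)] fibS[of i] by (simp_all only: ba)
    moreover obtain u v where "fiber (b a) = {u..v}"
      using that fiber_interval[OF lt] .
    ultimately have "fiber (b a) = {a..d}"
      using mx by simp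
    moreover have "i < k" using lt ba by simp
    ultimately show "I \<in> (\<lambda>i. fiber (2 * i + p)) ` {..<k}"
      using I(1) ba by auto
  qed
  show "(\<lambda>i. fiber (2 * i + p)) ` {..<k} \<subseteq> max_intervals ?S"
  proof clarify
    fix i assume "i < k"
    let ?F = "fiber (2 * i + p)"
    have lt: "2 * i + p < 2 * k" using \<open>i < k\<close> assms by simp
    note F = fiber_interval[OF lt]
    have ne: "?F \<noteq> {}" by (rule fiber_nonempty[OF lt])
    have mem: "Min ?F \<in> ?F" by (rule Min_in[OF _ ne]) simp
    obtain u v where uv: "?F = {u..v}" using that F .
    have maximal: "\<forall>c d. {u..v} \<subseteq> {c..d} \<and> {c..d} \<subseteq> ?S \<longrightarrow> {c..d} = {u..v}"
      unfolding uv[symmetric]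
    proof (intro allI impI, elim conjE)
      fix c d assume cd: "?F \<subseteq> {c..d}" "{c..d} \<subseteq> ?S"
      have "Min ?F \<in> fiber (b c)" using mem cd(1) sub[OF cd(2)] by blast
      then have "b c = 2 * i + p" using mem by simp
      then show "{c..d} = ?F" using sub[OF cd(2)] cd(1) by simp
    qed
    show "?F \<in> max_intervals ?S"
      unfolding max_intervals_def mem_Collect_eq
    proof (intro exI conjI)
      show "?F = {u..v}" by (rule uv)
      show "u \<le> v" using ne unfolding uv by simp
      show "{u..v} \<subseteq> ?S" using fibS[of i] unfolding uv .
      show "\<forall>c d. {u..v} \<subseteq> {c..d} \<and> {c..d} \<subseteq> ?S \<longrightarrow> {c..d} = {u..v}"
        by (rule maximal)
    qed
  qed
qed

lemma interval_list_parity_class: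
  assumes "p < 2"
  shows "interval_list {x \<in> {1..N}. b x mod 2 = p} = map (\<lambda>i. fiber (2 * i + p)) [0..<k]"
    (is "_ = ?xs")
proof -
  have less: "Min (fiber (2 * i + p)) < Min (fiber (2 * j + p))" if "i < j" "j < k" for i j
  proof -
    have "2 * i + p < 2 * k" "2 * j + p < 2 * k" using that assms by auto
    then have "Min (fiber (2 * i + p)) \<in> fiber (2 * i + p)" "Min (fiber (2 * j + p)) \<in> fiber (2 * j + p)"
      by (intro Min_in fiber_nonempty; simp)+
    then show ?thesis using less_if_level_less that by simp
  qed
  have sorted: "sorted_wrt (<) (map Min ?xs)"
    using less by (simp add: sorted_wrt_iff_nth_less)
  then have inj: "inj_on Min (set ?xs)" and dist: "distinct ?xs"
    using strict_sorted_iff distinct_map by blast+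
  have "sorted_key_list_of_set Min (set ?xs) = ?xs"
  proof (rule sorted_key_list_of_set_set)
    show "sorted (map Min ?xs)" using sorted unfolding strict_sorted_iff by blast
  qed (fact inj dist)+
  moreover have "set ?xs = max_intervals {x \<in> {1..N}. b x mod 2 = p}"
    using max_intervals_parity_class[OF assms] by (simp add: lessThan_atLeast0)
  ultimately show ?thesis
    unfolding interval_list_def by simp
qed

end

text \<open>By monotonicity the points of even level form the runs of openers, and those of odd level the
  runs of closers.\<close>

locale levelled_diagram = level_map N k b for N k b +
  fixes R :: "(nat \<times> nat) set"
  assumes diagram: "arc_diagram N R"
    and parity: "x \<in> {1..N} \<Longrightarrow> even (b x) \<longleftrightarrow> x \<in> fst ` R"
begin

lemmas D = arc_diagramD[OF diagram]

lemma openers_levels: "fst ` R = {x \<in> {1..N}. b x mod 2 = 0}"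
proof -
  have "fst ` R \<subseteq> {1..N}" using D(2) by force
  moreover have "b x mod 2 = 0 \<longleftrightarrow> x \<in> fst ` R" if "x \<in> {1..N}" for x
    by (fact parity[OF that, unfolded even_iff_mod_2_eq_zero])
  ultimately show ?thesis by (rule eq_Collect_in)
qed

lemma closers_levels: "snd ` R = {x \<in> {1..N}. b x mod 2 = 1}"
proof -
  have "snd ` R \<subseteq> {1..N}" using D(2) by force
  moreover have "b x mod 2 = 1 \<longleftrightarrow> x \<in> snd ` R" if "x \<in> {1..N}" for x
    using parity[OF that] D(5)[OF that] by (simp only: odd_iff_mod_2_eq_one[symmetric])
  ultimately show ?thesis by (rule eq_Collect_in)
qed

definition cell :: "nat \<times> nat \<Rightarrow> nat \<times> nat" where
  "cell = (\<lambda>(a, c). (b a div 2, b c div 2))"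

lemma arc_levels:
  assumes "(a, c) \<in> R"
  shows "b a = 2 * (b a div 2)" "b c = 2 * (b c div 2) + 1"
    "b a div 2 \<le> b c div 2" "b c div 2 < k"
proof -
  have "a \<in> fst ` R" "c \<in> snd ` R"
    using assms by force+
  then have "b a mod 2 = 0" "b c mod 2 = 1"
    unfolding openers_levels closers_levels by simp_all
  moreover have "b a \<le> b c"
    using mono D(1,2) assms by (meson less_imp_le)
  moreover have "b c \<in> {..<2 * k}"
    using D(2) assms onto by blast
  ultimately show "b a = 2 * (b a div 2)" "b c = 2 * (b c div 2) + 1"
    "b a div 2 \<le> b c div 2" "b c div 2 < k"
    unfolding lessThan_iff by presburger+
qed

lemma cell_bounds:
  assumes "s \<in> cell ` R"
  shows "fst s \<le> snd s" "snd s < k"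
  using assms arc_levels(3,4) by (auto simp: cell_def)

lemma psi_levels:
  assumes "R = arcs M"
  shows "psi M = mat k k (\<lambda>s. card {r \<in> R. cell r = s})"
proof -
  have "R \<inter> (fiber (2 * i) \<times> fiber (2 * j + 1)) = {r \<in> R. cell r = (i, j)}" for i j
    using arc_levels(1,2) D(2) by (fastforce simp: cell_def)
  then show ?thesis
    using interval_list_parity_class[of 0] interval_list_parity_class[of 1]
    unfolding psi_def openers_def closers_def assms[symmetric] openers_levels closers_levels
    by (auto simp: Let_def intro!: eq_matI)
qed

lemma sum_cells: "(\<Sum>s\<in>{0..<k} \<times> {0..<k}. card {r \<in> R. cell r = s}) = card R"
proof -
  have "cell ` R \<subseteq> {0..<k} \<times> {0..<k}"
    using cell_bounds by fastforce
  then show ?thesis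
    using sum.group[OF D(7), of "{0..<k} \<times> {0..<k}" cell "\<lambda>_. 1 :: nat"] by simp
qed

end

text \<open>The level of a point is the number of changes between openers and closers up to it. The point
  \<open>1\<close> must be an opener and \<open>N\<close> a closer, which fixes the parity of the levels and makes the number
  of levels even.\<close>

lemma levelled_diagram_exists:
  assumes R: "arc_diagram N R" and "N \<ge> 1"
  obtains k b where "levelled_diagram N k b R"
proof -
  note D = arc_diagramD[OF R]
  define t where "t x \<longleftrightarrow> x \<in> fst ` R" for x
  define W where "W = {y. 1 < y \<and> (t (y - 1) \<noteq> t y)}"
  define b where "b x = card (W \<inter> {..x})" for x
  have fin: "finite (W \<inter> {..x})" for x by simp
  have b1: "b (Suc 0) = 0"
    by (auto simp: b_def W_def)
  have bSuc: "b (Suc x) = (if t x = t (Suc x) then b x else Suc (b x))" if "x \<ge> 1" for x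
  proof -
    have "W \<inter> {..Suc x} = (if t x = t (Suc x) then W \<inter> {..x} else insert (Suc x) (W \<inter> {..x}))"
      using that by (auto simp: W_def le_Suc_eq)
    then show ?thesis by (simp add: b_def)
  qed
  have mono: "b x \<le> b y" if "x \<le> y" for x y
    using that unfolding b_def by (intro card_mono) auto
  have t1: "t 1"
  proof -
    have "1 \<notin> snd ` R"
      using D(1,2) by fastforce
    then show ?thesis using D(5)[of 1] \<open>N \<ge> 1\<close> by (auto simp: t_def)
  qed
  \<comment> \<open>an arc that starts at \<open>N\<close> would end beyond \<open>N\<close>\<close>
  have tN: "\<not> t N"
    using D(1,2) by (fastforce simp: t_def)
  have par: "even (b x) \<longleftrightarrow> t x" if "x \<ge> 1" for x
    using that
  proof (induction x rule: dec_induct)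
    case base
    then show ?case using b1 t1 by simp
  next
    case (step x)
    then show ?case using bSuc[of x] by auto
  qed
  have img: "b ` {1..x} = {..b x}" if "x \<ge> 1" for x
    using that
  proof (induction x rule: dec_induct)
    case base
    then show ?case using b1 by simp
  next
    case (step x)
    then have "{1..Suc x} = insert (Suc x) {1..x}" by auto
    then show ?case using step bSuc[of x] by (auto simp: atMost_Suc)
  qed
  define k where "k = Suc (b N) div 2"
  have "odd (b N)"
    using par tN \<open>N \<ge> 1\<close> by simp
  then have "{..b N} = {..<2 * k}"
    by (auto simp: k_def elim!: oddE)
  then have "levelled_diagram N k b R"
    using mono img[OF \<open>N \<ge> 1\<close>] R par by unfold_locales (auto simp: t_def)
  then show ?thesis by (rule that)
qed

section \<open>Keys of the endpoints\<close>

text \<open>The keys of the two endpoints of the arc in a given cell. The first component is the level;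
  the second one orders the points of a level, with a sign because closers come by decreasing
  row.\<close>

definition opener_key :: "nat \<times> nat \<Rightarrow> nat \<times> int" where
  "opener_key = (\<lambda>(i, j). (2 * i, int j))"

definition closer_key :: "nat \<times> nat \<Rightarrow> nat \<times> int" where
  "closer_key = (\<lambda>(i, j). (2 * j + 1, - int i))"

lemma inj_opener_key: "inj opener_key"
  by (auto simp: inj_def opener_key_def)

lemma inj_closer_key: "inj closer_key"
  by (auto simp: inj_def closer_key_def)

lemma opener_key_neq_closer_key: "opener_key s \<noteq> closer_key s'"
  by (auto simp: opener_key_def closer_key_def split: prod.split) presburger

text \<open>The set \<open>S\<close> of cells determines the set of values of \<open>h\<close>, hence \<open>h\<close> itself, hence the
  arcs.\<close>

definition key_labelling :: "(nat \<times> nat) set \<Rightarrow> nat \<Rightarrow> (nat \<times> nat) set \<Rightarrow> (nat \<Rightarrow> nat \<times> int) \<Rightarrow> bool"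
  where "key_labelling S N R h \<longleftrightarrow> strict_mono_on {1..N} h \<and> h ` {1..N} = opener_key ` S \<union> closer_key ` S \<and>
    R = {(a, c). a \<in> {1..N} \<and> c \<in> {1..N} \<and> (\<exists>s\<in>S. h a = opener_key s \<and> h c = closer_key s)}"

lemma strict_mono_on_image_unique:
  fixes f g :: "nat \<Rightarrow> 'a::linorder"
  assumes "strict_mono_on {1..N} f" "strict_mono_on {1..N} g" "f ` {1..N} = g ` {1..N}"
    and x: "x \<in> {1..N}"
  shows "f x = g x"
proof -
  have sorted: "sorted_wrt (<) (map h [1..<Suc N])" if "strict_mono_on {1..N} h" for h :: "nat \<Rightarrow> 'a"
    using that by (auto simp: sorted_wrt_iff_nth_less strict_mono_on_def simp del: upt_Suc)
  have "set (map g [1..<Suc N]) = set (map f [1..<Suc N])"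
    using assms(3) by (simp only: set_map set_upt atLeastLessThanSuc_atLeastAtMost)
  then have "map f [1..<Suc N] = map g [1..<Suc N]"
    using strict_sorted_equal[OF sorted[OF assms(1)] sorted[OF assms(2)]] by simp
  then show ?thesis
    using x by (simp del: upt_Suc)
qed

lemma key_labelling_unique:
  assumes "key_labelling S N R h" "key_labelling S N R' h'"
  shows "R = R'"
proof -
  have "h x = h' x" if "x \<in> {1..N}" for x
    using assms that by (intro strict_mono_on_image_unique[of N h h']) (auto simp: key_labelling_def)
  then have "{(a, c). a \<in> {1..N} \<and> c \<in> {1..N} \<and> (\<exists>s\<in>S. h a = opener_key s \<and> h c = closer_key s)}
      = {(a, c). a \<in> {1..N} \<and> c \<in> {1..N} \<and> (\<exists>s\<in>S. h' a = opener_key s \<and> h' c = closer_key s)}"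
    by (intro Collect_cong) (auto split: prod.split)
  then show ?thesis
    using assms unfolding key_labelling_def by simp
qed

section \<open>Matchings without left-nestings and right-crossings\<close>

context levelled_diagram
begin

text \<open>All points between two openers of the same level are openers of this level, so the rule for
  adjacent openers can be iterated.\<close>

lemma closers_increase:
  assumes "no_left_nesting R" "(a, c) \<in> R" "(a', c') \<in> R" "b a = b a'" "a < a'"
  shows "c < c'"
proof -
  have "\<exists>d. (x, d) \<in> R \<and> c < d" if "Suc a \<le> x" "x \<le> a'" for x
    using that
  proof (induction x rule: dec_induct)
    case base
    have "Suc a \<in> {1..N}" "b (Suc a) = b a"
      using assms base D(2) mono[of a "Suc a"] mono[of "Suc a" a'] by fastforce+
    then have "Suc a \<in> fst ` R" using parity assms D(2) by (metis fst_conv imageI)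
    then show ?case using assms(1,2) by (fastforce simp: no_left_nesting_def)
  next
    case (step x)
    then obtain d where d: "(x, d) \<in> R" "c < d" by auto
    have "Suc x \<in> {1..N}" "b (Suc x) = b a"
      using assms step D(2) mono[of a "Suc x"] mono[of "Suc x" a'] by fastforce+
    then have "Suc x \<in> fst ` R" using parity assms D(2) by (metis fst_conv imageI)
    then show ?case using assms(1) d by (fastforce simp: no_left_nesting_def)
  qed
  from this[of a'] show ?thesis using assms(3,5) D(3) by auto
qed

lemma openers_decrease:
  assumes "no_right_crossing R" "(a, c) \<in> R" "(a', c') \<in> R" "b c = b c'" "c < c'"
  shows "a' < a"
proof -
  have "\<exists>d. (d, x) \<in> R \<and> d < a" if "Suc c \<le> x" "x \<le> c'" for x
    using that
  proof (induction x rule: dec_induct)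
    case base
    have "Suc c \<in> {1..N}" "b (Suc c) = b c"
      using assms base D(2) mono[of c "Suc c"] mono[of "Suc c" c'] by fastforce+
    then have "Suc c \<in> snd ` R" using closers_levels assms by force
    then show ?case using assms(1,2) by (fastforce simp: no_right_crossing_def)
  next
    case (step x)
    then obtain d where d: "(d, x) \<in> R" "d < a" by auto
    have "Suc x \<in> {1..N}" "b (Suc x) = b c"
      using assms step D(2) mono[of c "Suc x"] mono[of "Suc x" c'] by fastforce+
    then have "Suc x \<in> snd ` R" using closers_levels assms by force
    then show ?case using assms(1) d by (fastforce simp: no_right_crossing_def)
  qed
  from this[of c'] show ?thesis using assms(3,5) D(4) by auto
qed

context
  assumes noLN: "no_left_nesting R" and noRC: "no_right_crossing R"
begin

text \<open>Strictness comes from the other rule: if the two closers were on the same level, their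
  partners would have to decrease.\<close>

lemma closer_levels_increase:
  assumes "(a, c) \<in> R" "(a', c') \<in> R" "b a = b a'" "a < a'"
  shows "b c < b c'"
proof -
  have "c < c'" using closers_increase[OF noLN] assms by blast
  moreover have "b c \<noteq> b c'"
    using openers_decrease[OF noRC assms(1,2)] \<open>c < c'\<close> assms(4) by auto
  ultimately show ?thesis using mono[of c c'] assms D(2) by fastforce
qed

lemma opener_levels_decrease:
  assumes "(a, c) \<in> R" "(a', c') \<in> R" "b c = b c'" "c < c'"
  shows "b a' < b a"
proof -
  have "a' < a" using openers_decrease[OF noRC] assms by blast
  moreover have "b a' \<noteq> b a"
    using closers_increase[OF noLN assms(2,1)] \<open>a' < a\<close> assms(4) by auto
  ultimately show ?thesis using mono[of a' a] assms D(2) by fastforce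
qed

lemma inj_cell: "inj_on cell R"
proof (rule inj_onI, clarify)
  fix a c a' c' assume R: "(a, c) \<in> R" "(a', c') \<in> R" and eq: "cell (a, c) = cell (a', c')"
  have "b a = b a'" "b c = b c'"
    using eq arc_levels(1,2)[OF R(1)] arc_levels(1,2)[OF R(2)] unfolding cell_def by (metis case_prod_conv prod.inject)+
  then have "a = a'"
    using closer_levels_increase[OF R] closer_levels_increase[OF R(2,1)] by (metis less_irrefl linorder_neqE_nat)
  then show "a = a' \<and> c = c'" using D(3) R by blast
qed

text \<open>Between different levels the keys increase because the levels do; within a level they
  increase by \<open>closer_levels_increase\<close> or \<open>opener_levels_decrease\<close>.\<close>

lemma key_labelling_exists: "\<exists>h. key_labelling (cell ` R) N R h"
proof -
  define h where "h x = (if x \<in> fst ` R then opener_key (cell (x, THE c. (x, c) \<in> R))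
    else closer_key (cell (THE a. (a, x) \<in> R, x)))" for x
  have ho: "h a = opener_key (cell (a, c))" and hc: "h c = closer_key (cell (a, c))" if "(a, c) \<in> R" for a c
  proof -
    have "(THE c. (a, c) \<in> R) = c" "(THE a. (a, c) \<in> R) = a" "c \<notin> fst ` R"
      using that D(3,4,6) by auto
    moreover have "a \<in> fst ` R" using that by force
    ultimately show "h a = opener_key (cell (a, c))" "h c = closer_key (cell (a, c))"
      by (simp_all add: h_def)
  qed
  have fsth: "fst (h x) = b x" if x: "x \<in> {1..N}" for x
  proof (cases "x \<in> fst ` R")
    case True
    then obtain c where "(x, c) \<in> R" by auto
    then show ?thesis using ho arc_levels by (simp add: cell_def opener_key_def)
  next
    case False
    then obtain a where "(a, x) \<in> R" using D(5) x by auto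
    then show ?thesis using hc arc_levels(2) by (simp add: cell_def closer_key_def)
  qed
  have "strict_mono_on {1..N} h"
  proof (rule strict_mono_onI)
    fix x y assume xy: "x \<in> {1..N}" "y \<in> {1..N}" "x < y"
    show "h x < h y"
    proof (cases "b x = b y")
      case False
      then show ?thesis using mono[of x y] xy fsth by (auto simp: less_prod_def)
    next
      case True
      show ?thesis
      proof (cases "x \<in> fst ` R")
        case True
        then have "y \<in> fst ` R" using parity \<open>b x = b y\<close> xy by metis
        then obtain c c' where R: "(x, c) \<in> R" "(y, c') \<in> R" using True by auto
        have "b c < b c'" using closer_levels_increase R \<open>b x = b y\<close> xy by blast
        then have "b c div 2 < b c' div 2" using arc_levels(2)[OF R(1)] arc_levels(2)[OF R(2)] by linarith
        then show ?thesis using ho[OF R(1)] ho[OF R(2)] \<open>b x = b y\<close> by (simp add: opener_key_def cell_def)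
      next
        case False
        then have "y \<notin> fst ` R" using parity \<open>b x = b y\<close> xy by metis
        then obtain a a' where R: "(a, x) \<in> R" "(a', y) \<in> R" using False D(5) xy by fastforce
        have "b a' < b a" using opener_levels_decrease R \<open>b x = b y\<close> xy by blast
        then have "b a' div 2 < b a div 2" using arc_levels(1)[OF R(1)] arc_levels(1)[OF R(2)] by linarith
        then show ?thesis using hc[OF R(1)] hc[OF R(2)] \<open>b x = b y\<close> by (simp add: closer_key_def cell_def)
      qed
    qed
  qed
  moreover have "h ` {1..N} = opener_key ` cell ` R \<union> closer_key ` cell ` R"
  proof -
    have "h ` fst ` R = opener_key ` cell ` R" "h ` snd ` R = closer_key ` cell ` R"
      using ho hc by (force simp: image_image intro!: image_cong)+
    then show ?thesis
      using diagram unfolding arc_diagram_def by (metis image_Un)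
  qed
  moreover have "R = {(a, c). a \<in> {1..N} \<and> c \<in> {1..N} \<and> (\<exists>s\<in>cell ` R. h a = opener_key s \<and> h c = closer_key s)}"
    (is "R = ?R'")
  proof
    show "R \<subseteq> ?R'" using ho hc D(2) by fastforce
    show "?R' \<subseteq> R"
    proof
      fix r assume "r \<in> ?R'"
      then obtain a c a' c' where r: "r = (a, c)" and ac: "a \<in> {1..N}" "c \<in> {1..N}"
        and R: "(a', c') \<in> R" and h: "h a = opener_key (cell (a', c'))" "h c = closer_key (cell (a', c'))"
        by auto
      have "h a = h a'" "h c = h c'" using h ho[OF R] hc[OF R] by simp_all
      then have "a = a'" "c = c'"
        using strict_mono_on_imp_inj_on[OF \<open>strict_mono_on {1..N} h\<close>] ac D(2)[OF R] by (meson inj_onD)+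
      then show "r \<in> R" using R r by simp
    qed
  qed
  ultimately show ?thesis unfolding key_labelling_def by blast
qed

lemma psi_indicator:
  assumes "R = arcs M"
  shows "psi M = mat k k (\<lambda>s. of_bool (s \<in> cell ` R))"
proof -
  have "card {r \<in> R. cell r = s} = of_bool (s \<in> cell ` R)" for s
  proof (cases "s \<in> cell ` R")
    case True
    then obtain r where "r \<in> R" "s = cell r" by auto
    then have "{r \<in> R. cell r = s} = {r}" using inj_cell by (auto dest: inj_onD)
    then show ?thesis using True by simp
  next
    case False
    then have "{r \<in> R. cell r = s} = {}" by auto
    then have "card {r \<in> R. cell r = s} = 0" by (simp only: card.empty)
    then show ?thesis using False by simp
  qed
  then show ?thesis using psi_levels[OF assms] by simp
qed

text \<open>Rows and columns are nonzero because every level is attained; the matrix is upper triangular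
  because an arc cannot end on a lower level than it starts.\<close>

lemma psi_in_T01:
  assumes "R = arcs M" "N = 2 * n"
  shows "psi M \<in> T01 n"
proof -
  have entry: "psi M $$ (i, j) = of_bool ((i, j) \<in> cell ` R)" if "i < k" "j < k" for i j
    using that psi_indicator[OF assms(1)] by simp
  have dim: "dim_row (psi M) = k" "dim_col (psi M) = k"
    using psi_indicator[OF assms(1)] by auto
  have row: "\<exists>j<k. (i, j) \<in> cell ` R" if "i < k" for i
  proof -
    have "2 * i \<in> b ` {1..N}" using onto that by simp
    then obtain x where x: "x \<in> {1..N}" "b x = 2 * i" by auto
    then obtain c where "(x, c) \<in> R" using parity[of x] by auto
    then show ?thesis using x arc_levels(4) by (force simp: cell_def image_iff)
  qed
  have col: "\<exists>i<k. (i, j) \<in> cell ` R" if "j < k" for j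
  proof -
    have "2 * j + 1 \<in> b ` {1..N}" using onto that by simp
    then obtain x where x: "x \<in> {1..N}" "b x = 2 * j + 1" by force
    then have "x \<in> snd ` R" unfolding closers_levels by simp
    then obtain a where a: "(a, x) \<in> R" by auto
    have "b a div 2 < k" "cell (a, x) = (b a div 2, j)"
      using arc_levels(3,4)[OF a] x by (simp_all add: cell_def)
    then show ?thesis using a by (metis image_eqI)
  qed
  have "sum_mat (psi M) = n"
  proof -
    have "sum_mat (psi M) = (\<Sum>s\<in>{0..<k} \<times> {0..<k}. card {r \<in> R. cell r = s})"
      unfolding sum_mat_def dim using psi_levels[OF assms(1)] by (intro sum.cong) auto
    then show ?thesis using sum_cells arc_diagram_card[OF diagram] assms(2) by simp
  qed
  moreover have "upper_triangular (psi M)"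
    using entry cell_bounds by (fastforce simp: upper_triangular_def dim)
  moreover have "\<exists>j<k. psi M $$ (i, j) \<noteq> 0" if "i < k" for i
    using row[OF that] entry that by force
  moreover have "\<exists>i<k. psi M $$ (i, j) \<noteq> 0" if "j < k" for j
    using col[OF that] entry that by force
  moreover have "elements_mat (psi M) \<subseteq> {0, 1}"
    using entry by (auto simp: elements_mat_def dim)
  ultimately show ?thesis
    by (simp add: T01_def T_def dim)
qed

end

end

section \<open>The matching of a matrix\<close>

lemma enumeration_exists:
  fixes P :: "'a::linorder set"
  assumes "finite P"
  obtains h where "strict_mono_on {1..card P} h" "h ` {1..card P} = P"
proof -
  define xs where "xs = sorted_list_of_set P"
  have xs: "sorted_wrt (<) xs" "length xs = card P" "set xs = P"
    using assms by (auto simp: xs_def)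
  show ?thesis
  proof (rule that[of "\<lambda>x. xs ! (x - 1)"])
    show "strict_mono_on {1..card P} (\<lambda>x. xs ! (x - 1))"
      using xs by (auto simp: strict_mono_on_def sorted_wrt_iff_nth_less)
    have "(\<lambda>x. x - 1) ` {1..card P} = {..<length xs}"
      unfolding xs(2) by (force simp: image_iff intro: bexI[of _ "Suc _"])
    then have "(\<lambda>x. xs ! (x - 1)) ` {1..card P} = (!) xs ` {..<length xs}"
      by (metis image_image)
    then show "(\<lambda>x. xs ! (x - 1)) ` {1..card P} = P"
      using xs(3) by (simp add: set_conv_nth image_def Bex_def) blast
  qed
qed

text \<open>The points are the keys of the nonzero cells in increasing order, and the first component of
  the key is a level map. Adjacent openers lie on the same level by \<open>level_constant\<close>, so their
  order is that of their columns, hence that of their partners; likewise for closers.\<close>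

lemma T01_preimage:
  assumes A: "A \<in> T01 n"
  obtains M where "matching_of n M" "left_nestings M = {}" "right_crossings M = {}" "psi M = A"
proof -
  define k where "k = dim_row A"
  have dim: "dim_row A = k" "dim_col A = k"
    using A by (auto simp: k_def T01_def T_def)
  define S where "S = {s \<in> {0..<k} \<times> {0..<k}. A $$ s \<noteq> 0}"
  \<comment> \<open>the entries being \<open>0\<close> or \<open>1\<close>, the matrix is the indicator of its support\<close>
  have entry: "A $$ s = of_bool (s \<in> S)" if "s \<in> {0..<k} \<times> {0..<k}" for s
  proof -
    have "A $$ s \<in> elements_mat A"
      using that dim by (cases s) (auto intro!: elements_matI[where nr = k and nc = k and i = "fst s" and j = "snd s"])
    then show ?thesis using A that by (auto simp: T01_def S_def)
  qed
  have upper: "i \<le> j \<and> j < k" if "(i, j) \<in> S" for i j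
    using that A dim by (force simp: S_def T01_def T_def upper_triangular_def not_less[symmetric])
  have row: "\<exists>j. (i, j) \<in> S" if "i < k" for i
    using that A dim by (force simp: S_def T01_def T_def)
  have col: "\<exists>i. (i, j) \<in> S" if "j < k" for j
    using that A dim by (force simp: S_def T01_def T_def)
  have finS: "finite S" by (simp add: S_def)
  have cardS: "card S = n"
  proof -
    have "n = (\<Sum>s\<in>{0..<k} \<times> {0..<k}. A $$ s)"
      using A dim by (simp add: T01_def T_def sum_mat_def)
    also have "\<dots> = (\<Sum>s\<in>{0..<k} \<times> {0..<k}. of_bool (s \<in> S))"
      using entry by (rule sum.cong[OF refl])
    also have "\<dots> = card S"
      by (simp add: S_def Int_def)
    finally show ?thesis by simp
  qed
  define P where "P = opener_key ` S \<union> closer_key ` S"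
  have "card P = card (opener_key ` S) + card (closer_key ` S)"
  proof (unfold P_def, rule card_Un_disjoint)
    show "opener_key ` S \<inter> closer_key ` S = {}" using opener_key_neq_closer_key by blast
  qed (use finS in simp_all)
  then have cardP: "card P = 2 * n"
    using inj_opener_key inj_closer_key cardS by (simp add: card_image inj_on_subset)
  obtain h where h: "strict_mono_on {1..2 * n} h" "h ` {1..2 * n} = P"
    using enumeration_exists[of P] finS cardP by (metis P_def finite_UnI finite_imageI)
  have hless: "h x < h y \<longleftrightarrow> x < y" if "x \<in> {1..2 * n}" "y \<in> {1..2 * n}" for x y
    using h(1) that by (metis strict_mono_on_less)
  have hinj: "x = y" if "h x = h y" "x \<in> {1..2 * n}" "y \<in> {1..2 * n}" for x y
    using that strict_mono_on_imp_inj_on[OF h(1)] by (auto dest: inj_onD)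
  define R where "R = {(a, c). a \<in> {1..2 * n} \<and> c \<in> {1..2 * n} \<and> (\<exists>s\<in>S. h a = opener_key s \<and> h c = closer_key s)}"
  have RI: "\<exists>a c. (a, c) \<in> R \<and> h a = opener_key s \<and> h c = closer_key s" if s: "s \<in> S" for s
  proof -
    have "opener_key s \<in> h ` {1..2 * n}" "closer_key s \<in> h ` {1..2 * n}"
      using s unfolding h(2) P_def by simp_all
    then obtain a c where "a \<in> {1..2 * n}" "c \<in> {1..2 * n}" "h a = opener_key s" "h c = closer_key s"
      by (metis imageE)
    then show ?thesis using s by (auto simp: R_def)
  qed
  have opener: "x \<in> fst ` R" if x: "x \<in> {1..2 * n}" "h x = opener_key s" "s \<in> S" for x s
  proof -
    obtain a c where a: "(a, c) \<in> R" "h a = opener_key s" using RI[OF x(3)] by blast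
    then have "a = x" using hinj[of a x] x by (simp add: R_def)
    then show ?thesis using a(1) by force
  qed
  have closer: "x \<in> snd ` R" if x: "x \<in> {1..2 * n}" "h x = closer_key s" "s \<in> S" for x s
  proof -
    obtain a c where c: "(a, c) \<in> R" "h c = closer_key s" using RI[OF x(3)] by blast
    then have "c = x" using hinj[of c x] x by (simp add: R_def)
    then show ?thesis using c(1) by force
  qed
  have key_cases: "(\<exists>s\<in>S. h x = opener_key s) \<or> (\<exists>s\<in>S. h x = closer_key s)" if "x \<in> {1..2 * n}" for x
    using that h(2) unfolding P_def by blast
  have diagram: "arc_diagram (2 * n) R"
    unfolding arc_diagram_def
  proof (intro conjI)
    show "\<forall>(a, c)\<in>R. a < c"
    proof clarify
      fix a c assume "(a, c) \<in> R"
      then obtain i j where s: "(i, j) \<in> S" "h a = opener_key (i, j)" "h c = closer_key (i, j)"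
        and ac: "a \<in> {1..2 * n}" "c \<in> {1..2 * n}" by (auto simp: R_def)
      \<comment> \<open>here \<open>i \<le> j\<close> gives \<open>2 * i < 2 * j + 1\<close>\<close>
      have "h a < h c" using s upper[OF s(1)] by (auto simp: opener_key_def closer_key_def)
      then show "a < c" using hless ac by simp
    qed
    show "inj_on fst R"
      using inj_opener_key hinj by (auto simp: R_def inj_on_def) (metis injD)+
    show "inj_on snd R"
      using inj_closer_key hinj by (auto simp: R_def inj_on_def) (metis injD)+
    show "fst ` R \<inter> snd ` R = {}"
      using opener_key_neq_closer_key by (fastforce simp: R_def)
    show "fst ` R \<union> snd ` R = {1..2 * n}"
    proof
      show "fst ` R \<union> snd ` R \<subseteq> {1..2 * n}" by (auto simp: R_def)
      show "{1..2 * n} \<subseteq> fst ` R \<union> snd ` R" using key_cases opener closer by blast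
    qed
  qed
  define b where "b x = fst (h x)" for x
  interpret levelled_diagram "2 * n" k b R
  proof
    show "b x \<le> b y" if "x \<in> {1..2 * n}" "y \<in> {1..2 * n}" "x \<le> y" for x y
      using hless[of x y] that by (cases "x = y") (auto simp: b_def less_prod_def)
    show "b ` {1..2 * n} = {..<2 * k}"
    proof -
      have "b ` {1..2 * n} = fst ` P" unfolding h(2)[symmetric] by (simp add: b_def image_image)
      also have "\<dots> = {..<2 * k}"
      proof
        show "fst ` P \<subseteq> {..<2 * k}"
          using upper by (fastforce simp: P_def opener_key_def closer_key_def)
        show "{..<2 * k} \<subseteq> fst ` P"
        proof
          fix v assume v: "v \<in> {..<2 * k}"
          show "v \<in> fst ` P"
          proof (cases "even v")
            case True
            then obtain i where "v = 2 * i" by (rule evenE)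
            moreover then obtain j where "(i, j) \<in> S" using row[of i] v by auto
            ultimately show ?thesis by (force simp: P_def opener_key_def)
          next
            case False
            then obtain j where "v = 2 * j + 1" by (rule oddE)
            moreover then obtain i where "(i, j) \<in> S" using col[of j] v by auto
            ultimately show ?thesis by (force simp: P_def closer_key_def)
          qed
        qed
      qed
      finally show ?thesis .
    qed
    show "arc_diagram (2 * n) R" by (rule diagram)
    show "even (b x) \<longleftrightarrow> x \<in> fst ` R" if x: "x \<in> {1..2 * n}" for x
      using key_cases[OF x]
    proof
      assume "\<exists>s\<in>S. h x = opener_key s"
      then show ?thesis using opener x by (auto simp: b_def opener_key_def)
    next
      assume "\<exists>s\<in>S. h x = closer_key s"
      then have "x \<in> snd ` R" "odd (b x)" using closer x by (auto simp: b_def closer_key_def)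
      then show ?thesis using diagram by (auto simp: arc_diagram_def)
    qed
  qed
  have cell_key: "h a = opener_key (cell (a, c))" "h c = closer_key (cell (a, c))" "cell (a, c) \<in> S" if "(a, c) \<in> R" for a c
    using that by (auto simp: R_def cell_def b_def opener_key_def closer_key_def)
  have cells: "cell ` R = S"
  proof
    show "cell ` R \<subseteq> S" using cell_key(3) by auto
    show "S \<subseteq> cell ` R"
    proof
      fix s assume "s \<in> S"
      then obtain a c where "(a, c) \<in> R" "h a = opener_key s" using RI by blast
      then show "s \<in> cell ` R" using cell_key(1) inj_opener_key by (metis image_eqI injD)
    qed
  qed
  have noLN: "no_left_nesting R"
    unfolding no_left_nesting_def
  proof (intro allI impI)
    fix a c c' assume R: "(a, c) \<in> R" "(Suc a, c') \<in> R"
    have "a \<in> fst ` R" "Suc a \<in> fst ` R"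
      using R by force+
    then have "{a..Suc a} \<subseteq> {x \<in> {1..2 * n}. b x mod 2 = 0}"
      unfolding openers_levels[symmetric] by (simp add: atLeastAtMostSuc_conv)
    then have eq: "b a = b (Suc a)" by (rule level_constant) simp
    have "h a < h (Suc a)" using hless D(2) R by blast
    then have "b c div 2 < b c' div 2"
      using cell_key(1)[OF R(1)] cell_key(1)[OF R(2)] eq by (simp add: opener_key_def cell_def)
    then have "b c < b c'" by linarith
    then show "c < c'" using less_if_level_less D(2) R by blast
  qed
  have noRC: "no_right_crossing R"
    unfolding no_right_crossing_def
  proof (intro allI impI)
    fix a a' c assume R: "(a, c) \<in> R" "(a', Suc c) \<in> R"
    have "c \<in> snd ` R" "Suc c \<in> snd ` R"
      using R by force+
    then have "{c..Suc c} \<subseteq> {x \<in> {1..2 * n}. b x mod 2 = 1}"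
      unfolding closers_levels[symmetric] by (simp add: atLeastAtMostSuc_conv)
    then have eq: "b c = b (Suc c)" by (rule level_constant) simp
    have "h c < h (Suc c)" using hless D(2) R by blast
    then have "b a' div 2 < b a div 2"
      using cell_key(2)[OF R(1)] cell_key(2)[OF R(2)] eq by (simp add: closer_key_def cell_def)
    then have "b a' < b a" by linarith
    then show "a' < a" using less_if_level_less D(2) R by blast
  qed
  define M where "M = (\<lambda>(a, c). {a, c}) ` R"
  have M: "matching_of n M" "arcs M = R"
    unfolding M_def using arcs_of_arc_diagram[OF diagram] by auto
  have "psi M = mat k k (\<lambda>s. of_bool (s \<in> S))"
    using psi_indicator[OF noLN noRC M(2)[symmetric]] cells by simp
  also have "\<dots> = A"
    using entry dim by (intro eq_matI) auto
  finally show ?thesis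
    using that M noLN noRC no_left_nesting_iff no_right_crossing_iff by simp
qed

section \<open>Bijectivity\<close>

text \<open>The support of \<open>psi M\<close> is the set of cells of the arcs, so matchings with the same image
  have key labellings over the same set of cells.\<close>

lemma psi_injective:
  assumes "n \<ge> 1" and M: "matching_of n M" "left_nestings M = {}" "right_crossings M = {}"
    and M': "matching_of n M'" "left_nestings M' = {}" "right_crossings M' = {}"
    and eq: "psi M = psi M'"
  shows "M = M'"
proof -
  have lab: "\<exists>h. key_labelling {s \<in> {0..<dim_row (psi L)} \<times> {0..<dim_col (psi L)}. psi L $$ s \<noteq> 0} (2 * n) (arcs L) h"
    if L: "matching_of n L" "left_nestings L = {}" "right_crossings L = {}" for L
  proof -
    obtain k b where "levelled_diagram (2 * n) k b (arcs L)"
      using levelled_diagram_exists[OF matching_arc_diagram[OF L(1)]] \<open>n \<ge> 1\<close> by auto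
    then interpret levelled_diagram "2 * n" k b "arcs L" .
    have good: "no_left_nesting (arcs L)" "no_right_crossing (arcs L)"
      using L no_left_nesting_iff no_right_crossing_iff by auto
    have "{s \<in> {0..<dim_row (psi L)} \<times> {0..<dim_col (psi L)}. psi L $$ s \<noteq> 0} = cell ` arcs L"
    proof -
      have "cell ` arcs L \<subseteq> {0..<k} \<times> {0..<k}"
        using cell_bounds by fastforce
      then have "cell ` arcs L = {s \<in> {0..<k} \<times> {0..<k}. psi L $$ s \<noteq> 0}"
      proof (rule eq_Collect_in)
        fix s assume "s \<in> {0..<k} \<times> {0..<k}"
        then show "psi L $$ s \<noteq> 0 \<longleftrightarrow> s \<in> cell ` arcs L"
          by (cases s) (simp add: psi_indicator[OF good refl])
      qed
      moreover have "dim_row (psi L) = k" "dim_col (psi L) = k"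
        by (simp_all add: psi_indicator[OF good refl])
      ultimately show ?thesis by simp
    qed
    then show ?thesis using key_labelling_exists[OF good] by simp
  qed
  have "arcs M = arcs M'"
    using lab[OF M] lab[OF M'] key_labelling_unique unfolding eq by blast
  then show ?thesis
    using matching_from_arcs[OF M(1)] matching_from_arcs[OF M'(1)] by simp
qed

theorem proposition12:
  fixes n :: nat
  assumes "n \<ge> 1"
  shows "bij_betw psi
           {M. matching_of n M \<and> left_nestings M = {} \<and> right_crossings M = {}}
           (T01 n)"
proof (rule bij_betw_imageI)
  let ?X = "{M. matching_of n M \<and> left_nestings M = {} \<and> right_crossings M = {}}"
  show "inj_on psi ?X"
    using psi_injective[OF assms] by (intro inj_onI) simp
  show "psi ` ?X = T01 n"
  proof
    show "psi ` ?X \<subseteq> T01 n"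
    proof clarify
      fix M assume M: "matching_of n M" "left_nestings M = {}" "right_crossings M = {}"
      obtain k b where "levelled_diagram (2 * n) k b (arcs M)"
        using levelled_diagram_exists[OF matching_arc_diagram[OF M(1)]] assms by auto
      then interpret levelled_diagram "2 * n" k b "arcs M" .
      show "psi M \<in> T01 n"
        using psi_in_T01 M no_left_nesting_iff no_right_crossing_iff by blast
    qed
    show "T01 n \<subseteq> psi ` ?X"
    proof
      fix A assume "A \<in> T01 n"
      then obtain M where "matching_of n M" "left_nestings M = {}" "right_crossings M = {}" "psi M = A"
        by (rule T01_preimage)
      then show "A \<in> psi ` ?X" by blast
    qed
  qed
qed

end
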